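(* Let $\mathcal{G}$ be a finite simple graph embedded in the complex plane, and let $\vec{x}=(\vec{x}_{\vec{e}})_{\vec{e}\in\vec{E}(\mathcal{G})}$ be a system of nonzero complex weights on its directed edges. Then the operator norm (induced by the Euclidean norm) of the conjugated transition matrix $\Lambda(\vec{x})$ is $$\|\Lambda(\vec{x})\|=\max_{z\in V(\mathcal{G})}\xi^z(\vec{x}).$$
   Context: $V(\mathcal{G})$ is the set of vertices of $\mathcal{G}$, identified with the corresponding complex numbers. $\vec{E}(\mathcal{G})$ is the set of directed edges: ordered pairs $\vec{e}=(z,w)$ with $\{z,w\}$ an edge; the tail is $t(\vec{e})=z$, the head $h(\vec{e})=w$, the reversal $-\vec{e}=(w,z)$. $\mathrm{Out}_{\mathcal{G}}(z)=\{\vec{e}\in\vec{E}(\mathcal{G}):t(\vec{e})=z\}$. The turning angle is $\angle(\vec{e},\vec{g})=\mathrm{Arg}\Big(\frac{h(\vec{g})-t(\vec{g})}{h(\vec{e})-t(\vec{e})}\Big)\in(-\pi,\pi]$. The conjugated transition matrix $\Lambda(\vec{x})$, indexed by $\vec{E}(\mathcal{G})\times\vec{E}(\mathcal{G})$, has entries $$\Lambda_{\vec{e},\vec{g}}(\vec{x})=\begin{cases}\vec{x}_{-\vec{e}}\,\vec{x}_{\vec{g}}\,e^{\frac{i}{2}\angle(\vec{e},\vec{g})}&\text{if }h(\vec{e})=t(\vec{g})\text{ and }\vec{g}\neq-\vec{e},\\0&\text{otherwise.}\end{cases}$$ For $z\in V(\mathcal{G})$, $\xi^z(\vec{x})$ is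 defined to be the unique solution in $s$ of the equation $\sum_{\vec{e}\in\mathrm{Out}_{\mathcal{G}}(z)}\arctan\big(|\vec{x}_{\vec{e}}|^2/s\big)=\frac{\pi}{2}$. *)

theory Defs
  imports "HOL-Analysis.Analysis" "Graph_Theory.Pair_Digraph"
begin

text \<open>
  A finite simple graph with vertices in the complex plane is a
  \<^typ>\<open>complex pair_pre_digraph\<close> satisfying \<^locale>\<open>pair_graph\<close>: a finite, loopless, symmetric
  set of arcs without multiplicities. Thus \<^term>\<open>parcs G\<close> is the set of directed edges
  (each undirected edge giving two of them), \<^term>\<open>fst\<close> is the tail, \<^term>\<open>snd\<close> the head and
  \<^term>\<open>prod.swap\<close> the reversal.

  Edges are drawn as straight segments, which is what turning angles refer to. The drawing is an
  embedding if no edge passes through a vertex and distinct edges do not meet in their interiors.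
\<close>

definition straight_line_embedded :: "complex pair_pre_digraph \<Rightarrow> bool" where
  "straight_line_embedded G \<longleftrightarrow>
     (\<forall>e\<in>parcs G. \<forall>z\<in>pverts G. z \<notin> open_segment (fst e) (snd e)) \<and>
     (\<forall>e\<in>parcs G. \<forall>g\<in>parcs G. g \<noteq> e \<and> g \<noteq> prod.swap e \<longrightarrow>
        open_segment (fst e) (snd e) \<inter> open_segment (fst g) (snd g) = {})"

definition turning_angle :: "complex \<times> complex \<Rightarrow> complex \<times> complex \<Rightarrow> real" where
  "turning_angle e g = Arg ((snd g - fst g) / (snd e - fst e))"

definition transition_matrix ::
    "(complex \<times> complex \<Rightarrow> complex) \<Rightarrow> complex \<times> complex \<Rightarrow> complex \<times> complex \<Rightarrow> complex" where
  "transition_matrix x e g =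
     (if snd e = fst g \<and> g \<noteq> prod.swap e
      then x (prod.swap e) * x g * exp (\<i> / 2 * complex_of_real (turning_angle e g))
      else 0)"

text \<open>
  The operator norm, induced by the Euclidean norm, of a complex matrix with rows and columns
  indexed by a finite set \<open>I\<close>; the formula is that of \<^const>\<open>onorm\<close>, where the vectors are the
  restrictions to \<open>I\<close> of the functions \<open>v\<close>. For \<open>I = {}\<close> it is \<open>0\<close>, since \<open>0 / 0 = 0\<close>.
\<close>

definition matrix_opnorm :: "'i set \<Rightarrow> ('i \<Rightarrow> 'i \<Rightarrow> complex) \<Rightarrow> real" where
  "matrix_opnorm I A =
     (SUP v :: 'i \<Rightarrow> complex.
        L2_set (\<lambda>i. norm (\<Sum>j\<in>I. A i j * v j)) I / L2_set (\<lambda>i. norm (v i)) I)"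

lemma matrix_opnorm_UNIV_eq_onorm:
  fixes A :: "complex ^ 'n ^ 'n"
  shows "matrix_opnorm UNIV (\<lambda>i j. A $ i $ j) = onorm (\<lambda>v. A *v v)"
proof -
  have "(SUP v :: complex ^ 'n. norm (A *v v) / norm v)
        = (SUP v :: 'n \<Rightarrow> complex. norm (A *v vec_lambda v) / norm (vec_lambda v :: complex ^ 'n))"
    (is "Sup (range ?f) = Sup (range ?g)")
  proof -
    have "range ?f = range ?g"
    proof (intro equalityI subsetI)
      fix y assume "y \<in> range ?f"
      then obtain v where "y = ?f v" by blast
      then have "y = ?g (vec_nth v)" by simp
      then show "y \<in> range ?g" by blast
    qed blast
    then show ?thesis by simp
  qed
  then show ?thesis
    unfolding matrix_opnorm_def onorm_def
    by (simp add: norm_vec_def matrix_vector_mult_def)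
qed

text \<open>
  The function \<open>arctan (a / s)\<close> of \<open>s\<close>, with \<open>a > 0\<close>, under the convention that
  \<open>arctan (a / 0) = arctan \<infinity> = pi / 2\<close> (in HOL, \<open>a / 0 = 0\<close>). At a vertex of
  degree one the defining equation of \<open>\<xi>\<close> then has the solution \<open>0\<close>; at a vertex of degree at
  least two the convention is immaterial, as \<open>s = 0\<close> is not a solution.
\<close>

definition arctan_quot :: "real \<Rightarrow> real \<Rightarrow> real" where
  "arctan_quot a s = (if s = 0 then pi / 2 else arctan (a / s))"

text \<open>At an isolated vertex the sum is empty, the equation has no solution, and \<open>\<xi>\<close> is \<open>0\<close>.\<close>

definition xi ::
    "complex pair_pre_digraph \<Rightarrow> (complex \<times> complex \<Rightarrow> complex) \<Rightarrow> complex \<Rightarrow> real" where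
  "xi G x z =
     (if out_arcs (with_proj G) z = {} then 0
      else THE s. (\<Sum>e\<in>out_arcs (with_proj G) z. arctan_quot ((norm (x e))\<^sup>2) s) = pi / 2)"

lemma arctan_quot_sum_ex1:
  fixes a :: "'e \<Rightarrow> real"
  assumes fin: "finite S" and ne: "S \<noteq> {}" and pos: "\<And>e. e \<in> S \<Longrightarrow> 0 < a e"
  shows "\<exists>!s. (\<Sum>e\<in>S. arctan_quot (a e) s) = pi / 2"
proof -
  define F where "F s = (\<Sum>e\<in>S. arctan_quot (a e) s)" for s
  have neg: "F s \<le> 0" if "s < 0" for s
    unfolding F_def using that pos
    by (intro sum_nonpos) (force simp: arctan_quot_def divide_nonneg_neg less_imp_le)
  have anti: "F t < F s" if "0 \<le> s" "s < t" for s t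
    unfolding F_def
  proof (rule sum_strict_mono[OF fin ne])
    fix e assume "e \<in> S"
    then have "0 < a e" by (rule pos)
    then show "arctan_quot (a e) t < arctan_quot (a e) s"
      using that arctan_ubound[of "a e / t"]
      by (auto simp: arctan_quot_def arctan_less_iff divide_strict_left_mono)
  qed
  have ex: "\<exists>s. F s = pi / 2"
  proof (cases "card S = 1")
    case True
    then obtain e where "S = {e}" by (auto simp: card_1_singleton_iff)
    then have "F 0 = pi / 2" by (simp add: F_def arctan_quot_def)
    then show ?thesis ..
  next
    case False
    have "card S \<noteq> 0" using fin ne by simp
    with False have c: "card S \<ge> 2" by linarith
    have "((\<lambda>s. \<Sum>e\<in>S. arctan (a e / s)) \<longlongrightarrow> (\<Sum>e\<in>S. pi / 2)) (at_right 0)"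
    proof (rule tendsto_sum)
      fix e assume "e \<in> S"
      then have "LIM s at_right 0. a e / s :> at_top"
        by (auto intro!: filterlim_tendsto_pos_mult_at_top[OF tendsto_const] pos
             filterlim_inverse_at_top_right simp: divide_inverse)
      then show "((\<lambda>s. arctan (a e / s)) \<longlongrightarrow> pi / 2) (at_right 0)"
        by (rule filterlim_compose[OF tendsto_arctan_at_top])
    qed
    moreover have "pi / 2 < (\<Sum>e\<in>S. pi / 2)"
      using c pi_gt_zero by (simp add: mult_strict_right_mono)
    ultimately have "eventually (\<lambda>s. pi / 2 < (\<Sum>e\<in>S. arctan (a e / s))) (at_right 0)"
      by (rule order_tendstoD)
    moreover have "eventually (\<lambda>s. 0 < s) (at_right (0::real))"
      by (rule eventually_at_right_less)
    ultimately have "eventually (\<lambda>s. pi / 2 < (\<Sum>e\<in>S. arctan (a e / s)) \<and> 0 < s) (at_right 0)"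
      by (rule eventually_conj)
    then obtain s1 where s1: "pi / 2 < (\<Sum>e\<in>S. arctan (a e / s1))" "0 < s1"
      using eventually_happens trivial_limit_at_right_real by (metis (no_types, lifting))
    have "((\<lambda>s. \<Sum>e\<in>S. arctan (a e / s)) \<longlongrightarrow> (\<Sum>e\<in>S. arctan 0)) at_top"
      by (intro tendsto_sum tendsto_arctan real_tendsto_divide_at_top[OF tendsto_const]
           filterlim_ident)
    moreover have "(\<Sum>e\<in>S. arctan 0) < pi / 2" by simp
    ultimately have "eventually (\<lambda>s. (\<Sum>e\<in>S. arctan (a e / s)) < pi / 2) at_top"
      by (rule order_tendstoD)
    then have "eventually (\<lambda>s. (\<Sum>e\<in>S. arctan (a e / s)) < pi / 2 \<and> s1 \<le> s) at_top"
      by (intro eventually_conj eventually_ge_at_top)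
    then obtain s2 where s2: "(\<Sum>e\<in>S. arctan (a e / s2)) < pi / 2" "s1 \<le> s2"
      by (auto simp: eventually_at_top_linorder)
    have "\<exists>s\<ge>s1. s \<le> s2 \<and> (\<Sum>e\<in>S. arctan (a e / s)) = pi / 2"
      using s1 s2 by (intro IVT2') (auto intro!: continuous_intros)
    then obtain s where "s \<ge> s1" "(\<Sum>e\<in>S. arctan (a e / s)) = pi / 2" by blast
    then have "F s = pi / 2" using s1(2) by (simp add: F_def arctan_quot_def)
    then show ?thesis ..
  qed
  have uniq: "s = t" if "F s = pi / 2" "F t = pi / 2" for s t
  proof -
    have "0 \<le> s" "0 \<le> t" using that neg[of s] neg[of t] pi_gt_zero by force+
    then show ?thesis using anti[of s t] anti[of t s] that by linarith
  qed
  from ex uniq show ?thesis unfolding F_def by blast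
qed

end

theory Submission
  imports Defs
begin

text \<open>
  Only edges \<open>e\<close>, \<open>g\<close> with \<open>h(e) = t(g) = z\<close> interact, so \<open>\<Lambda>\<close> splits into blocks indexed by the
  vertices; rows are relabelled by reversal. Since no two edges leave \<open>z\<close> in the same direction,
  the half turning angle is a difference of half arguments up to a factor \<open>\<plusminus>\<i>\<close>, and the block at \<open>z\<close>
  is, up to diagonal unitary factors, the matrix \<open>sgn (j - k) r\<^sub>j r\<^sub>k\<close> with \<open>r\<^sub>k = \<bar>x\<^sub>k\<bar>\<close> and the edges
  out of \<open>z\<close> ordered by argument.

  Let \<open>P\<^sub>k\<close> be the partial sums of \<open>r\<^sub>k y\<^sub>k\<close>. The sequence \<open>T\<^sub>k = 2 P\<^sub>k - P\<^sub>n\<close> satisfies \<open>T\<^sub>n = - T\<^sub>0\<close>; its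
  differences are \<open>2 r\<^sub>k y\<^sub>k\<close>, and its sums of neighbours are twice the entries of the matrix product,
  divided by \<open>r\<^sub>k\<close>. With \<open>tan \<theta>\<^sub>k = r\<^sub>k\<^sup>2 / s\<close>, the difference of \<open>s\<^sup>2 \<parallel>y\<parallel>\<^sup>2\<close> and the squared norm of the
  product is a positive multiple of the sum of the actions of the harmonic oscillator going from
  \<open>T\<^sub>k\<close> to \<open>T\<^sub>k\<^sub>+\<^sub>1\<close> in time \<open>2 \<theta>\<^sub>k\<close>. The action is superadditive under concatenation of paths, and it
  vanishes for two consecutive paths from \<open>a\<close> to \<open>b\<close> to \<open>- a\<close> of total time \<open>\<pi>\<close>, which is the value of
  \<open>2 (\<theta>\<^sub>0 + \<dots> + \<theta>\<^sub>n\<^sub>-\<^sub>1)\<close> when \<open>s = \<xi>\<close>. Equality holds for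
  \<open>T\<^sub>k = exp (2 \<i> (\<theta>\<^sub>0 + \<dots> + \<theta>\<^sub>k\<^sub>-\<^sub>1))\<close>.
\<close>

section \<open>The action of the harmonic oscillator\<close>

text \<open>Up to a factor, the action of the harmonic oscillator going from \<open>a\<close> to \<open>b\<close> in time \<open>t\<close>.\<close>

definition osc :: "real \<Rightarrow> real \<Rightarrow> real \<Rightarrow> real" where
  "osc t a b = (cos t * (a\<^sup>2 + b\<^sup>2) - 2 * a * b) / sin t"

text \<open>After clearing denominators the gap is a perfect square, which vanishes when
  \<open>b\<close> is the position at time \<open>t\<close> of the oscillator going from
  \<open>a\<close> to \<open>c\<close> in time \<open>t + u\<close>. All three sines are positive
  because \<open>t + u < pi\<close>.\<close>

lemma osc_superadditive:
  assumes "0 < t" "0 < u" "t + u < pi"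
  shows "osc (t + u) a c \<le> osc t a b + osc u b c"
proof -
  have p: "0 < sin t" "0 < sin u" "0 < sin (t + u)"
    using assms by (auto intro!: sin_gt_zero)
  have "sin (t + u) * sin u * (cos t * (a\<^sup>2 + b\<^sup>2) - 2 * a * b)
      + sin (t + u) * sin t * (cos u * (b\<^sup>2 + c\<^sup>2) - 2 * b * c)
      - sin t * sin u * (cos (t + u) * (a\<^sup>2 + c\<^sup>2) - 2 * a * c)
      = (sin (t + u) * b - sin u * a - sin t * c)\<^sup>2"
    using sin_cos_squared_add[of t] sin_cos_squared_add[of u]
    unfolding sin_add cos_add by algebra
  then have "osc t a b + osc u b c - osc (t + u) a c
      = (sin (t + u) * b - sin u * a - sin t * c)\<^sup>2 / (sin t * sin u * sin (t + u))"
    using p by (simp add: osc_def field_simps)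
  moreover have "\<dots> \<ge> 0"
    using p by (intro divide_nonneg_pos) auto
  ultimately show ?thesis by linarith
qed

text \<open>Paths are appended one at a time; each partial total time stays below \<open>pi\<close>,
  as superadditivity requires.\<close>

lemma osc_sum_superadditive:
  assumes pos: "\<And>k. k < n \<Longrightarrow> 0 < t k" and "0 < m" "m \<le> n" "(\<Sum>k<m. t k) < pi"
  shows "osc (\<Sum>k<m. t k) (T 0) (T m) \<le> (\<Sum>k<m. osc (t k) (T k) (T (Suc k)))"
  using assms(2-)
proof (induction m)
  case (Suc m)
  have tm: "0 < t m" using pos Suc.prems by simp
  show ?case
  proof (cases "m = 0")
    case False
    have s: "0 < (\<Sum>k<m. t k)" using False pos Suc.prems by (intro sum_pos) auto
    have "osc (\<Sum>k<Suc m. t k) (T 0) (T (Suc m))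
        \<le> osc (\<Sum>k<m. t k) (T 0) (T m) + osc (t m) (T m) (T (Suc m))"
      using osc_superadditive[OF s tm] Suc.prems by simp
    moreover have "osc (\<Sum>k<m. t k) (T 0) (T m) \<le> (\<Sum>k<m. osc (t k) (T k) (T (Suc k)))"
      using Suc False tm by simp
    ultimately show ?thesis by simp
  qed simp
qed simp

text \<open>Total time \<open>pi\<close> is out of reach of superadditivity, as
  \<open>sin pi = 0\<close>. Hence all paths but the last are merged into one of time
  \<open>u\<close>, which cancels against the last: passing to time \<open>pi - u\<close> and
  endpoint \<open>- T 0\<close> keeps the sine and flips the numerator.\<close>

lemma osc_sum_antiperiodic_nonneg:
  assumes pos: "\<And>k. k < n \<Longrightarrow> 0 < t k" and n: "2 \<le> n"
    and sum: "(\<Sum>k<n. t k) = pi" and anti: "T n = - T 0"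
  shows "0 \<le> (\<Sum>k<n. osc (t k) (T k) (T (Suc k)))"
proof -
  obtain m where m: "n = Suc m" "0 < m" using n by (cases n) auto
  define u where "u = (\<Sum>k<m. t k)"
  have tm: "0 < t m" "t m = pi - u" using pos[of m] m sum by (auto simp: u_def)
  have "osc u (T 0) (T m) \<le> (\<Sum>k<m. osc (t k) (T k) (T (Suc k)))"
    unfolding u_def using pos m tm by (intro osc_sum_superadditive[of n]) (auto simp: u_def)
  moreover have "osc u (T 0) (T m) + osc (t m) (T m) (T (Suc m)) = 0"
    using anti unfolding tm(2) osc_def m by (simp add: add_divide_distrib[symmetric])
  ultimately show ?thesis by (simp add: m)
qed

text \<open>The left side is the contribution of one coordinate to the norm gap, with
  \<open>a = T k\<close> and \<open>b = T (Suc k)\<close>. The double angle formulas make both sides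
  rational in \<open>w\<close>, the tangent of half the time.\<close>

lemma osc_eq:
  fixes a b r s :: real
  assumes "0 < r" "0 < s"
  shows "s\<^sup>2 * ((b - a) / (2 * r))\<^sup>2 - (r * ((a + b) / 2))\<^sup>2
    = s / 2 * osc (2 * arctan (r\<^sup>2 / s)) a b"
proof -
  define w where "w = r\<^sup>2 / s"
  have w: "0 < w" using assms by (simp add: w_def)
  have n1: "1 + w\<^sup>2 \<noteq> 0" using zero_le_power2[of w] by linarith
  have d: "cos (arctan w) \<noteq> 0" "cos (arctan w) ^ 2 = 1 / (1 + w\<^sup>2)" "sin (arctan w) = w * cos (arctan w)"
    using w n1 by (auto simp: cos_arctan sin_arctan power_divide real_sqrt_pow2)
  have S: "sin (2 * arctan w) = 2 * w / (1 + w\<^sup>2)"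
    by (simp add: sin_double d(3)) (metis d(2) mult.assoc power2_eq_square mult_1_right times_divide_eq_right)
  have C: "cos (2 * arctan w) = (1 - w\<^sup>2) / (1 + w\<^sup>2)"
    unfolding cos_double d(3) power_mult_distrib d(2) by (simp add: diff_divide_distrib)
  have r: "r\<^sup>2 = w * s" using assms by (simp add: w_def)
  have "osc (2 * arctan w) a b = ((1 - w\<^sup>2) * (a\<^sup>2 + b\<^sup>2) - 2 * a * b * (1 + w\<^sup>2)) / (2 * w)"
    unfolding osc_def S C using w n1 by (simp add: divide_simps)
  moreover have "s\<^sup>2 * ((b - a) / (2 * r))\<^sup>2 - (r * ((a + b) / 2))\<^sup>2
     = s\<^sup>2 * (b - a)\<^sup>2 / (4 * (w * s)) - w * s * (a + b)\<^sup>2 / 4"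
    by (simp add: power_divide power_mult_distrib r)
  moreover have "\<dots> = s / 2 * (((1 - w\<^sup>2) * (a\<^sup>2 + b\<^sup>2) - 2 * a * b * (1 + w\<^sup>2)) / (2 * w))"
    using w assms by (simp add: field_simps power2_eq_square)
  ultimately show ?thesis by (simp add: w_def)
qed

section \<open>The sign kernel on an initial segment of the naturals\<close>

text \<open>Termwise, the sign is \<open>[j < k] + [j < Suc k] - 1\<close>.\<close>

lemma sum_sgn_diff:
  fixes z :: "nat \<Rightarrow> 'a::real_vector"
  assumes "k < n"
  shows "(\<Sum>j<n. sgn (real k - real j) *\<^sub>R z j) = (\<Sum>j<k. z j) + (\<Sum>j<Suc k. z j) - (\<Sum>j<n. z j)"
proof -
  have "(\<Sum>j<n. sgn (real k - real j) *\<^sub>R z j)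
    = (\<Sum>j<n. (if j < k then z j else 0) + (if j < Suc k then z j else 0) - z j)"
    by (intro sum.cong refl) (auto simp: sgn_if)
  also have "\<dots> = (\<Sum>j<n. if j < k then z j else 0) + (\<Sum>j<n. if j < Suc k then z j else 0) - (\<Sum>j<n. z j)"
    by (simp add: sum.distrib sum_subtractf)
  also have "(\<Sum>j<n. if j < k then z j else 0) = (\<Sum>j<k. z j)"
    using assms by (intro sum.mono_neutral_cong_right) auto
  also have "(\<Sum>j<n. if j < Suc k then z j else 0) = (\<Sum>j<Suc k. z j)"
    using assms by (intro sum.mono_neutral_cong_right) auto
  finally show ?thesis .
qed

lemma sgn_matrix_bound_real:
  fixes r y :: "nat \<Rightarrow> real"
  assumes r: "\<And>k. k < n \<Longrightarrow> 0 < r k" and s: "0 < s" and n: "2 \<le> n"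
    and sum: "(\<Sum>k<n. arctan ((r k)\<^sup>2 / s)) = pi / 2"
  shows "(\<Sum>k<n. (r k * (\<Sum>j<n. sgn (real k - real j) * (r j * y j)))\<^sup>2) \<le> s\<^sup>2 * (\<Sum>k<n. (y k)\<^sup>2)"
proof -
  \<comment> \<open>Subtracting the full sum makes \<open>T 0\<close> and \<open>T n\<close>
    opposite and leaves the differences unchanged.\<close>
  define T where "T k = 2 * (\<Sum>j<k. r j * y j) - (\<Sum>j<n. r j * y j)" for k
  have "s\<^sup>2 * (y k)\<^sup>2 - (r k * (\<Sum>j<n. sgn (real k - real j) * (r j * y j)))\<^sup>2
      = s / 2 * osc (2 * arctan ((r k)\<^sup>2 / s)) (T k) (T (Suc k))" if "k < n" for k
  proof -
    have "y k = (T (Suc k) - T k) / (2 * r k)"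
      using r[OF that] by (simp add: T_def field_simps)
    moreover have "(\<Sum>j<n. sgn (real k - real j) * (r j * y j)) = (T (Suc k) + T k) / 2"
      using sum_sgn_diff[OF that, of "\<lambda>j. r j * y j"] by (simp add: T_def field_simps)
    ultimately show ?thesis
      using osc_eq[OF r[OF that] s, of "T (Suc k)" "T k"] by (simp only: add.commute)
  qed
  then have "s\<^sup>2 * (\<Sum>k<n. (y k)\<^sup>2) - (\<Sum>k<n. (r k * (\<Sum>j<n. sgn (real k - real j) * (r j * y j)))\<^sup>2)
      = s / 2 * (\<Sum>k<n. osc (2 * arctan ((r k)\<^sup>2 / s)) (T k) (T (Suc k)))"
    unfolding sum_distrib_left sum_subtractf[symmetric] by (intro sum.cong) auto
  moreover have "0 \<le> (\<Sum>k<n. osc (2 * arctan ((r k)\<^sup>2 / s)) (T k) (T (Suc k)))"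
  proof (rule osc_sum_antiperiodic_nonneg[OF _ n])
    show "0 < 2 * arctan ((r k)\<^sup>2 / s)" if "k < n" for k
      using r[OF that] s by simp
  qed (use sum in \<open>simp_all add: T_def flip: sum_distrib_left\<close>)
  ultimately show ?thesis using s by (smt (verit) mult_nonneg_nonneg half_gt_zero)
qed

text \<open>The kernel is real, so the real and imaginary parts of \<open>y\<close> can be bounded
  separately.\<close>

lemma sgn_matrix_bound:
  fixes r :: "nat \<Rightarrow> real" and y :: "nat \<Rightarrow> complex"
  assumes r: "\<And>k. k < n \<Longrightarrow> 0 < r k" and s: "0 < s" and n: "2 \<le> n"
    and sum: "(\<Sum>k<n. arctan ((r k)\<^sup>2 / s)) = pi / 2"
  shows "(\<Sum>k<n. (r k * norm (\<Sum>j<n. sgn (real k - real j) *\<^sub>R (r j *\<^sub>R y j)))\<^sup>2)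
    \<le> s\<^sup>2 * (\<Sum>k<n. (norm (y k))\<^sup>2)"
proof -
  define c where "c k = (\<Sum>j<n. sgn (real k - real j) *\<^sub>R (r j *\<^sub>R y j))" for k
  have c: "Re (c k) = (\<Sum>j<n. sgn (real k - real j) * (r j * Re (y j)))"
    "Im (c k) = (\<Sum>j<n. sgn (real k - real j) * (r j * Im (y j)))" for k
    by (simp_all only: c_def Re_sum Im_sum scaleR_complex.sel)
  have "(\<Sum>k<n. (r k * norm (c k))\<^sup>2) = (\<Sum>k<n. (r k * Re (c k))\<^sup>2) + (\<Sum>k<n. (r k * Im (c k))\<^sup>2)"
    by (simp add: power_mult_distrib cmod_power2 distrib_left sum.distrib)
  also have "\<dots> \<le> s\<^sup>2 * (\<Sum>k<n. (Re (y k))\<^sup>2) + s\<^sup>2 * (\<Sum>k<n. (Im (y k))\<^sup>2)"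
    unfolding c by (intro add_mono sgn_matrix_bound_real[OF r s n sum])
  also have "\<dots> = s\<^sup>2 * (\<Sum>k<n. (norm (y k))\<^sup>2)"
    by (simp add: cmod_power2 sum.distrib distrib_left)
  finally show ?thesis unfolding c_def .
qed

text \<open>Factoring out the midpoint of an arc of length \<open>2 * u\<close> gives the moduli of
  the sum and the difference of its ends.\<close>

lemma cis_sum_diff:
  shows "cis (t + 2 * u) + cis t = of_real (2 * cos u) * cis (t + u)"
    and "cis (t + 2 * u) - cis t = \<i> * of_real (2 * sin u) * cis (t + u)"
proof -
  have "cis (t + 2 * u) = cis (t + u) * cis u" "cis t = cis (t + u) * cis (- u)"
    by (simp_all add: cis_mult algebra_simps)
  moreover have "cis u + cis (- u) = of_real (2 * cos u)" "cis u - cis (- u) = \<i> * of_real (2 * sin u)"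
    by (auto simp: complex_eq_iff)
  ultimately show "cis (t + 2 * u) + cis t = of_real (2 * cos u) * cis (t + u)"
    "cis (t + 2 * u) - cis t = \<i> * of_real (2 * sin u) * cis (t + u)"
    by (metis distrib_left mult.commute, metis right_diff_distrib' mult.commute)
qed

text \<open>With \<open>T\<close> moving on the unit circle, consecutive differences and sums have
  moduli \<open>2 * sin (\<theta> k)\<close> and \<open>2 * cos (\<theta> k)\<close>. Their ratio is
  \<open>(r k)\<^sup>2 / s\<close>, so equality holds in every coordinate and not just in
  total.\<close>

lemma sgn_matrix_extremal:
  fixes r :: "nat \<Rightarrow> real"
  assumes r: "\<And>k. k < n \<Longrightarrow> 0 < r k" and s: "0 < s"
    and sum: "(\<Sum>k<n. arctan ((r k)\<^sup>2 / s)) = pi / 2"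
  obtains y :: "nat \<Rightarrow> complex" where "\<And>k. k < n \<Longrightarrow> y k \<noteq> 0"
    "\<And>k. k < n \<Longrightarrow> r k * norm (\<Sum>j<n. sgn (real k - real j) *\<^sub>R (r j *\<^sub>R y j)) = s * norm (y k)"
proof -
  define \<theta> where "\<theta> k = arctan ((r k)\<^sup>2 / s)" for k
  define T where "T k = cis (\<Sum>j<k. 2 * \<theta> j)" for k
  define y where "y k = (T (Suc k) - T k) /\<^sub>R (2 * r k)" for k
  have "(\<Sum>j<n. 2 * \<theta> j) = pi"
    using sum by (simp add: \<theta>_def flip: sum_distrib_left)
  then have Tn: "T n = - 1" "T 0 = 1" by (simp_all add: T_def)
  have th: "0 < cos (\<theta> k)" "sin (\<theta> k) = (r k)\<^sup>2 / s * cos (\<theta> k)" "0 < sin (\<theta> k)" if "k < n" for k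
    using r[OF that] s by (auto simp: \<theta>_def cos_arctan sin_arctan add_pos_nonneg)
  have ry: "(\<Sum>j<m. r j *\<^sub>R y j) = (1 / 2) *\<^sub>R (T m - 1)" if "m \<le> n" for m
  proof -
    have "(\<Sum>j<m. r j *\<^sub>R y j) = (\<Sum>j<m. (1 / 2) *\<^sub>R (T (Suc j) - T j))"
    proof (intro sum.cong refl)
      fix j assume "j \<in> {..<m}"
      then have "r j \<noteq> 0" using r[of j] that by auto
      then show "r j *\<^sub>R y j = (1 / 2) *\<^sub>R (T (Suc j) - T j)" by (simp add: y_def)
    qed
    also have "\<dots> = (1 / 2) *\<^sub>R (T m - T 0)"
      by (simp only: scaleR_sum_right[symmetric] sum_lessThan_telescope)
    finally show ?thesis by (simp add: Tn)
  qed
  have n1: "norm (T (Suc k) - T k) = 2 * sin (\<theta> k)" "norm (T (Suc k) + T k) = 2 * cos (\<theta> k)" if "k < n" for k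
    using th(1,3)[OF that] cis_sum_diff[of "\<Sum>j<k. 2 * \<theta> j" "\<theta> k"] by (simp_all add: T_def norm_mult)
  show ?thesis
  proof
    fix k assume k: "k < n"
    have ny: "norm (y k) = sin (\<theta> k) / r k"
    proof -
      have "norm (y k) = \<bar>inverse (2 * r k)\<bar> * (2 * sin (\<theta> k))"
        by (simp only: y_def norm_scaleR n1(1)[OF k])
      then show ?thesis using r[OF k] by (simp add: field_simps)
    qed
    then show "y k \<noteq> 0" using th[OF k] r[OF k] by auto
    have "(\<Sum>j<n. sgn (real k - real j) *\<^sub>R (r j *\<^sub>R y j)) = (1 / 2) *\<^sub>R (T (Suc k) + T k)"
      unfolding sum_sgn_diff[OF k] using k by (simp add: ry Tn algebra_simps del: sum.lessThan_Suc)
    then have "norm (\<Sum>j<n. sgn (real k - real j) *\<^sub>R (r j *\<^sub>R y j)) = cos (\<theta> k)"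
      using n1(2)[OF k] by simp
    then show "r k * norm (\<Sum>j<n. sgn (real k - real j) *\<^sub>R (r j *\<^sub>R y j)) = s * norm (y k)"
      using s r[OF k] by (simp add: ny th(2)[OF k] power2_eq_square)
  qed
qed

section \<open>Transfer to an arbitrary finite index set\<close>

text \<open>The sign kernel depends only on the order of the values of \<open>\<alpha>\<close>, so
  sorting them lets positions replace values.\<close>

lemma finite_strict_mono_enumeration:
  fixes \<alpha> :: "'e \<Rightarrow> real"
  assumes "finite S" "inj_on \<alpha> S"
  obtains h where "bij_betw h {..<card S} S"
    "\<And>j k. j < card S \<Longrightarrow> k < card S \<Longrightarrow> sgn (\<alpha> (h j) - \<alpha> (h k)) = sgn (real j - real k)"
proof -
  define A where "A = sorted_list_of_set (\<alpha> ` S)"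
  have A: "length A = card S" "set A = \<alpha> ` S" "distinct A" "sorted_wrt (<) A"
    using assms by (simp_all add: A_def card_image)
  have bA: "bij_betw (\<lambda>k. A ! k) {..<card S} (\<alpha> ` S)"
    using bij_betw_nth[OF A(3)] A by simp
  have bS: "bij_betw (inv_into S \<alpha>) (\<alpha> ` S) S"
    using assms(2) by (intro bij_betw_inv_into) (simp add: bij_betw_def)
  define h where "h = inv_into S \<alpha> \<circ> (\<lambda>k. A ! k)"
  have \<alpha>h: "\<alpha> (h k) = A ! k" if "k < card S" for k
    using bij_betwE[OF bA] that by (auto simp: h_def intro!: f_inv_into_f)
  have "sgn (\<alpha> (h j) - \<alpha> (h k)) = sgn (real j - real k)" if "j < card S" "k < card S" for j k
    using sorted_wrt_nth_less[OF A(4), of j k] sorted_wrt_nth_less[OF A(4), of k j] that A(1)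
    by (cases j k rule: linorder_cases) (auto simp: \<alpha>h)
  then show ?thesis using that[of h] bij_betw_trans[OF bA bS] by (simp add: h_def)
qed

text \<open>Negative \<open>s\<close> makes the sum nonpositive. One term equals
  \<open>pi / 2\<close> only at \<open>s = 0\<close>, while several terms sum to more than
  \<open>pi / 2\<close> there. In the second case \<open>arctan_quot\<close> is an honest
  arctangent.\<close>

lemma arctan_quot_sum_cases:
  fixes a :: "'e \<Rightarrow> real"
  assumes fin: "finite S" and pos: "\<And>e. e \<in> S \<Longrightarrow> 0 < a e"
    and sum: "(\<Sum>e\<in>S. arctan_quot (a e) s) = pi / 2"
  obtains e where "S = {e}" "s = 0" | "2 \<le> card S" "0 < s"
proof -
  have s0: "0 \<le> s"
  proof (rule ccontr)
    assume "\<not> 0 \<le> s"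
    then have "(\<Sum>e\<in>S. arctan_quot (a e) s) \<le> 0"
      using pos by (intro sum_nonpos) (force simp: arctan_quot_def divide_nonneg_neg less_imp_le)
    then show False using sum pi_gt_zero by linarith
  qed
  have "card S \<noteq> 0" using sum fin by auto
  then consider "card S = 1" | "2 \<le> card S" by linarith
  then show ?thesis
  proof cases
    case 1
    then obtain e where e: "S = {e}" by (auto simp: card_1_singleton_iff)
    then have "s = 0"
      using sum arctan_ubound[of "a e / s"] by (auto simp: arctan_quot_def split: if_splits)
    then show ?thesis using e that by blast
  next
    case 2
    have "s \<noteq> 0" using sum 2 by (auto simp: arctan_quot_def)
    then show ?thesis using 2 s0 that by simp
  qed
qed

lemma sgn_kernel_bound:
  fixes \<alpha> r :: "'e \<Rightarrow> real" and y :: "'e \<Rightarrow> complex"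
  assumes fin: "finite S" and inj: "inj_on \<alpha> S" and r: "\<And>e. e \<in> S \<Longrightarrow> 0 < r e"
    and sum: "(\<Sum>e\<in>S. arctan_quot ((r e)\<^sup>2) s) = pi / 2"
  shows "(\<Sum>f\<in>S. (r f * norm (\<Sum>g\<in>S. sgn (\<alpha> f - \<alpha> g) *\<^sub>R (r g *\<^sub>R y g)))\<^sup>2)
    \<le> s\<^sup>2 * (\<Sum>f\<in>S. (norm (y f))\<^sup>2)"
proof -
  have r2: "0 < (r e)\<^sup>2" if "e \<in> S" for e using r[OF that] by simp
  consider e where "S = {e}" "s = 0" | "2 \<le> card S" "0 < s"
    using arctan_quot_sum_cases[OF fin r2 sum] by blast
  then show ?thesis
  proof cases
    case (1 e)
    then show ?thesis by simp
  next
    case 2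
    obtain h where h: "bij_betw h {..<card S} S"
      "\<And>j k. j < card S \<Longrightarrow> k < card S \<Longrightarrow> sgn (\<alpha> (h j) - \<alpha> (h k)) = sgn (real j - real k)"
      using finite_strict_mono_enumeration[OF fin inj] by blast
    have hS: "h k \<in> S" if "k < card S" for k using bij_betwE[OF h(1)] that by simp
    note re = sum.reindex_bij_betw[OF h(1), symmetric]
    show ?thesis
      using sgn_matrix_bound[of "card S" "\<lambda>k. r (h k)" s "\<lambda>k. y (h k)"] 2 r hS sum h(2)
      by (simp add: re arctan_quot_def)
  qed
qed

lemma sgn_kernel_extremal:
  fixes \<alpha> r :: "'e \<Rightarrow> real"
  assumes fin: "finite S" and inj: "inj_on \<alpha> S" and r: "\<And>e. e \<in> S \<Longrightarrow> 0 < r e"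
    and sum: "(\<Sum>e\<in>S. arctan_quot ((r e)\<^sup>2) s) = pi / 2"
  obtains y :: "'e \<Rightarrow> complex" where "\<And>f. f \<in> S \<Longrightarrow> y f \<noteq> 0"
    "\<And>f. f \<in> S \<Longrightarrow> r f * norm (\<Sum>g\<in>S. sgn (\<alpha> f - \<alpha> g) *\<^sub>R (r g *\<^sub>R y g)) = s * norm (y f)"
proof -
  have r2: "0 < (r e)\<^sup>2" if "e \<in> S" for e using r[OF that] by simp
  consider e where "S = {e}" "s = 0" | "2 \<le> card S" "0 < s"
    using arctan_quot_sum_cases[OF fin r2 sum] by blast
  then show ?thesis
  proof cases
    case (1 e)
    \<comment> \<open>The one-by-one kernel and \<open>s\<close> are both 0, so any nonvanishing
      vector is extremal.\<close>
    then show ?thesis using that[of "\<lambda>_. 1"] by simp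
  next
    case 2
    obtain h where h: "bij_betw h {..<card S} S"
      "\<And>j k. j < card S \<Longrightarrow> k < card S \<Longrightarrow> sgn (\<alpha> (h j) - \<alpha> (h k)) = sgn (real j - real k)"
      using finite_strict_mono_enumeration[OF fin inj] by blast
    have hS: "h k \<in> S" if "k < card S" for k using bij_betwE[OF h(1)] that by simp
    note re = sum.reindex_bij_betw[OF h(1), symmetric]
    have "(\<Sum>k<card S. arctan ((r (h k))\<^sup>2 / s)) = pi / 2"
      using sum 2 by (simp add: re arctan_quot_def)
    then obtain y :: "nat \<Rightarrow> complex" where y: "\<And>k. k < card S \<Longrightarrow> y k \<noteq> 0"
      "\<And>k. k < card S \<Longrightarrow> r (h k) * norm (\<Sum>j<card S. sgn (real k - real j) *\<^sub>R (r (h j) *\<^sub>R y j))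
        = s * norm (y k)"
      using sgn_matrix_extremal[of "card S" "\<lambda>k. r (h k)" s] r hS 2 by blast
    define i where "i = inv_into {..<card S} h"
    have i: "i f < card S" "h (i f) = f" if "f \<in> S" for f
      using bij_betwE[OF bij_betw_inv_into[OF h(1)]] bij_betw_inv_into_right[OF h(1)] that
      by (auto simp: i_def)
    have ih: "i (h k) = k" if "k < card S" for k
      using bij_betw_inv_into_left[OF h(1)] that by (simp add: i_def)
    show ?thesis
    proof (rule that[of "\<lambda>f. y (i f)"])
      fix f assume f: "f \<in> S"
      show "y (i f) \<noteq> 0" using y i f by simp
      have "(\<Sum>g\<in>S. sgn (\<alpha> f - \<alpha> g) *\<^sub>R (r g *\<^sub>R y (i g)))
          = (\<Sum>j<card S. sgn (real (i f) - real j) *\<^sub>R (r (h j) *\<^sub>R y j))"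
        unfolding re by (intro sum.cong refl) (use i[OF f] h(2) ih in force)
      then show "r f * norm (\<Sum>g\<in>S. sgn (\<alpha> f - \<alpha> g) *\<^sub>R (r g *\<^sub>R y (i g))) = s * norm (y (i f))"
        using y(2)[of "i f"] i[OF f] by simp
    qed
  qed
qed

section \<open>Half turning angles as differences of half arguments\<close>

text \<open>Here \<open>- a\<close> is the direction of the incoming edge, the reversal of an
  outgoing one. The angle is \<open>Arg b - Arg a\<close> shifted by \<open>pi\<close> or
  \<open>- pi\<close>, whichever lands in the principal range; half of this shift produces
  \<open>\<i>\<close> times the sign.\<close>

lemma exp_half_turning_angle:
  assumes "a \<noteq> 0" "b \<noteq> 0" "Arg a \<noteq> Arg b"
  shows "exp (\<i> / 2 * of_real (Arg (b / - a)))
    = \<i> * of_real (sgn (Arg a - Arg b)) * cis (Arg b / 2) * cis (- (Arg a / 2))"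
proof -
  define \<sigma> where "\<sigma> = sgn (Arg a - Arg b)"
  have \<sigma>: "\<sigma> = 1 \<and> Arg b < Arg a \<or> \<sigma> = - 1 \<and> Arg a < Arg b"
    using assms(3) by (auto simp: \<sigma>_def sgn_if)
  have "sgn (b / - a) = - (cis (Arg b) / cis (Arg a))"
    using assms by (simp add: cis_Arg sgn_divide)
  also have "\<dots> = cis (Arg b - Arg a + \<sigma> * pi)"
    using \<sigma> by (auto simp: cis_divide complex_eq_iff)
  finally have "Arg (b / - a) = Arg b - Arg a + \<sigma> * pi"
    using \<sigma> Arg_bounded[of a] Arg_bounded[of b] by (intro cis_Arg_unique) auto
  then have "exp (\<i> / 2 * of_real (Arg (b / - a))) = cis (Arg b / 2 - Arg a / 2 + \<sigma> * pi / 2)"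
    by (simp add: cis_conv_exp add_divide_distrib diff_divide_distrib right_diff_distrib distrib_left)
  also have "\<dots> = cis (\<sigma> * pi / 2) * cis (Arg b / 2) * cis (- (Arg a / 2))"
    by (simp add: cis_mult algebra_simps)
  also have "cis (\<sigma> * pi / 2) = \<i> * of_real \<sigma>"
    using \<sigma> by (auto simp: complex_eq_iff)
  finally show ?thesis by (simp add: \<sigma>_def)
qed

abbreviation edge_arg :: "complex \<times> complex \<Rightarrow> real" where
  "edge_arg e \<equiv> Arg (snd e - fst e)"

section \<open>The blocks of the transition matrix at the vertices\<close>

lemma (in pair_graph) sum_parcs_eq_sum_out_arcs:
  fixes F :: "'a \<times> 'a \<Rightarrow> 'b::comm_monoid_add"
  shows "(\<Sum>e\<in>parcs G. F e) = (\<Sum>z\<in>pverts G. \<Sum>f\<in>out_arcs (with_proj G) z. F f)"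
proof -
  have "fst ` parcs G \<subseteq> pverts G" using arc_fst_in_verts by (rule image_subsetI)
  from sum.group[OF pair_finite_arcs pair_finite_verts this, of F] show ?thesis
    by (simp add: out_arcs_def)
qed

text \<open>Relabelling rows by reversal lets the edges out of \<open>z\<close> index both rows and
  columns of the block at \<open>z\<close>.\<close>

lemma (in pair_graph) sum_parcs_swap:
  "(\<Sum>e\<in>parcs G. F (prod.swap e)) = (\<Sum>e\<in>parcs G. F e)"
proof -
  have "bij_betw prod.swap (parcs G) (parcs G)"
    by (rule bij_betw_byWitness[where f' = prod.swap]) (auto intro: arcs_symmetric)
  then show ?thesis by (rule sum.reindex_bij_betw)
qed

locale weighted_embedded_graph = pair_graph G
  for G :: "complex pair_pre_digraph" +
  fixes x :: "complex \<times> complex \<Rightarrow> complex"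
  assumes embedded: "straight_line_embedded G"
    and nonzero: "\<And>e. e \<in> parcs G \<Longrightarrow> x e \<noteq> 0"
begin

text \<open>Two edges leaving \<open>z\<close> in the same direction would overlap near
  \<open>z\<close>, against the embedding.\<close>

lemma inj_on_edge_arg_out_arcs:
  "inj_on edge_arg (out_arcs (with_proj G) z)"
proof (rule inj_onI, rule ccontr)
  fix f g assume fg: "f \<in> out_arcs (with_proj G) z" "g \<in> out_arcs (with_proj G) z"
    "edge_arg f = edge_arg g" "f \<noteq> g"
  then obtain a b where ab: "f = (z, a)" "g = (z, b)" by (cases f, cases g) auto
  have ne: "a \<noteq> z" "b \<noteq> z" using pair_no_loops[of f] pair_no_loops[of g] fg ab by auto
  define c where "c = norm (b - z) / norm (a - z)"
  have c: "0 < c" using ne by (simp add: c_def)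
  have "sgn (b - z) = sgn (a - z)"
    using fg(3) ne cis_Arg[of "a - z"] cis_Arg[of "b - z"] by (simp add: ab)
  then have "b - z = norm (b - z) *\<^sub>R sgn (a - z)"
    by (metis sgn_div_norm scaleR_scaleR right_inverse scaleR_one norm_eq_zero eq_iff_diff_eq_0 ne(2))
  then have bc: "b - z = c *\<^sub>R (a - z)"
    by (simp add: sgn_div_norm c_def divide_inverse)
  \<comment> \<open>The common point has parameter \<open>t\<close> on the segment to
    \<open>a\<close> and \<open>t / c\<close> on the one to \<open>b\<close>; this choice keeps both
    below 1.\<close>
  define t where "t = min 1 c / 2"
  have t: "0 < t" "t < 1" "t < c" using c by (auto simp: t_def min_def)
  define p where "p = (1 - t) *\<^sub>R z + t *\<^sub>R a"
  have "p \<in> open_segment z a" using ne t by (auto simp: in_segment p_def)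
  moreover have "p = (1 - t / c) *\<^sub>R z + (t / c) *\<^sub>R b"
  proof -
    have "p = z + (t / c) *\<^sub>R (b - z)" using c by (simp add: p_def bc algebra_simps)
    then show ?thesis by (simp add: algebra_simps)
  qed
  then have "p \<in> open_segment z b" using ne t c by (auto simp: in_segment intro!: exI[of _ "t / c"])
  moreover have "open_segment z a \<inter> open_segment z b = {}"
  proof -
    have "g \<noteq> f" "g \<noteq> prod.swap f" "f \<in> parcs G" "g \<in> parcs G" using fg ab ne by auto
    then have "open_segment (fst f) (snd f) \<inter> open_segment (fst g) (snd g) = {}"
      using embedded unfolding straight_line_embedded_def by blast
    then show ?thesis by (simp add: ab)
  qed
  ultimately show False by blast
qed

text \<open>The phase depending on \<open>f\<close> factors out of the row and disappears in the
  norm; the phases depending on \<open>g\<close> are absorbed into the vector.\<close>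

lemma norm_transition_matrix_row:
  assumes f: "f \<in> out_arcs (with_proj G) z"
  shows "norm (\<Sum>g\<in>parcs G. transition_matrix x (prod.swap f) g * v g)
    = norm (x f) * norm (\<Sum>g\<in>out_arcs (with_proj G) z. sgn (edge_arg f - edge_arg g) *\<^sub>R
        (norm (x g) *\<^sub>R (sgn (x g) * cis (edge_arg g / 2) * v g)))"
proof -
  have "(\<Sum>g\<in>parcs G. transition_matrix x (prod.swap f) g * v g)
      = (\<Sum>g\<in>out_arcs (with_proj G) z. transition_matrix x (prod.swap f) g * v g)"
    using f pair_finite_arcs by (intro sum.mono_neutral_right) (auto simp: transition_matrix_def)
  also have "\<dots> = (\<Sum>g\<in>out_arcs (with_proj G) z. (\<i> * x f * cis (- (edge_arg f / 2))) *
      (sgn (edge_arg f - edge_arg g) *\<^sub>R (norm (x g) *\<^sub>R (sgn (x g) * cis (edge_arg g / 2) * v g))))"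
  proof (intro sum.cong refl)
    fix g assume g: "g \<in> out_arcs (with_proj G) z"
    show "transition_matrix x (prod.swap f) g * v g = (\<i> * x f * cis (- (edge_arg f / 2))) *
      (sgn (edge_arg f - edge_arg g) *\<^sub>R (norm (x g) *\<^sub>R (sgn (x g) * cis (edge_arg g / 2) * v g)))"
    proof (cases "g = f")
      \<comment> \<open>The exclusion of backtracking agrees with \<open>sgn 0 = 0\<close> on the
        diagonal.\<close>
      case True
      then show ?thesis by (simp add: transition_matrix_def)
    next
      case False
      then have "edge_arg f \<noteq> edge_arg g"
        using inj_onD[OF inj_on_edge_arg_out_arcs _ f g] by auto
      moreover have "snd f - fst f \<noteq> 0" "snd g - fst g \<noteq> 0"
        using pair_no_loops[of f] pair_no_loops[of g] f g by auto
      ultimately have e: "exp (\<i> / 2 * of_real (turning_angle (prod.swap f) g))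
          = \<i> * of_real (sgn (edge_arg f - edge_arg g)) * cis (edge_arg g / 2) * cis (- (edge_arg f / 2))"
        using exp_half_turning_angle[of "snd f - fst f" "snd g - fst g"]
        by (simp add: turning_angle_def)
      have xg: "x g = of_real (norm (x g)) * sgn (x g)"
        using nonzero[of g] g by (simp add: sgn_eq)
      have "transition_matrix x (prod.swap f) g
          = x f * x g * exp (\<i> / 2 * of_real (turning_angle (prod.swap f) g))"
        using f g False by (auto simp: transition_matrix_def)
      also have "\<dots> = x f * (of_real (norm (x g)) * sgn (x g))
          * exp (\<i> / 2 * of_real (turning_angle (prod.swap f) g))"
        using xg by (rule arg_cong)
      finally show ?thesis unfolding e scaleR_conv_of_real by (simp only: mult_ac)
    qed
  qed
  also have "\<dots> = (\<i> * x f * cis (- (edge_arg f / 2))) * (\<Sum>g\<in>out_arcs (with_proj G) z.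
      sgn (edge_arg f - edge_arg g) *\<^sub>R (norm (x g) *\<^sub>R (sgn (x g) * cis (edge_arg g / 2) * v g)))"
    by (rule sum_distrib_left[symmetric])
  finally show ?thesis by (simp only: norm_mult norm_ii norm_cis mult_1_left mult_1_right)
qed

lemma xi_eqI:
  assumes "out_arcs (with_proj G) z \<noteq> {}"
  shows "(\<Sum>e\<in>out_arcs (with_proj G) z. arctan_quot ((norm (x e))\<^sup>2) (xi G x z)) = pi / 2"
proof -
  have "\<exists>!s. (\<Sum>e\<in>out_arcs (with_proj G) z. arctan_quot ((norm (x e))\<^sup>2) s) = pi / 2"
    using assms nonzero by (intro arctan_quot_sum_ex1) auto
  from theI'[OF this] show ?thesis using assms by (simp add: xi_def)
qed

lemma xi_nonneg:
  shows "0 \<le> xi G x z"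
proof (cases "out_arcs (with_proj G) z = {}")
  case True
  then show ?thesis by (simp add: xi_def)
next
  case False
  have p: "0 < (norm (x e))\<^sup>2" if "e \<in> out_arcs (with_proj G) z" for e
    using nonzero that by simp
  show ?thesis
    by (rule arctan_quot_sum_cases[OF finite_out_arcs p xi_eqI[OF False]]) auto
qed

lemma transition_matrix_block_bound:

  shows "(\<Sum>f\<in>out_arcs (with_proj G) z. (norm (\<Sum>g\<in>parcs G. transition_matrix x (prod.swap f) g * v g))\<^sup>2)
    \<le> (xi G x z)\<^sup>2 * (\<Sum>f\<in>out_arcs (with_proj G) z. (norm (v f))\<^sup>2)"
proof (cases "out_arcs (with_proj G) z = {}")
  case False
  \<comment> \<open>The weights out of \<open>z\<close> are nonzero, so these phases have modulus 1
    and preserve norms.\<close>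
  define y where "y g = sgn (x g) * cis (edge_arg g / 2) * v g" for g
  have y: "norm (y g) = norm (v g)" if "g \<in> out_arcs (with_proj G) z" for g
    using nonzero[of g] that by (simp add: y_def norm_mult norm_sgn)
  have "(\<Sum>f\<in>out_arcs (with_proj G) z. (norm (x f) * norm (\<Sum>g\<in>out_arcs (with_proj G) z.
        sgn (edge_arg f - edge_arg g) *\<^sub>R (norm (x g) *\<^sub>R y g)))\<^sup>2)
      \<le> (xi G x z)\<^sup>2 * (\<Sum>f\<in>out_arcs (with_proj G) z. (norm (y f))\<^sup>2)"
    using nonzero by (intro sgn_kernel_bound finite_out_arcs inj_on_edge_arg_out_arcs xi_eqI[OF False]) auto
  then show ?thesis
    using norm_transition_matrix_row[of _ z v] y by (simp add: y_def)
qed simp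

lemma transition_matrix_block_extremal:
  assumes ne: "out_arcs (with_proj G) z \<noteq> {}"
  obtains v where "\<And>f. f \<in> out_arcs (with_proj G) z \<Longrightarrow> v f \<noteq> 0"
    "\<And>f. f \<notin> out_arcs (with_proj G) z \<Longrightarrow> v f = 0"
    "\<And>f. f \<in> out_arcs (with_proj G) z \<Longrightarrow>
      norm (\<Sum>g\<in>parcs G. transition_matrix x (prod.swap f) g * v g) = xi G x z * norm (v f)"
proof -
  have x': "0 < norm (x f)" if "f \<in> out_arcs (with_proj G) z" for f using nonzero that by simp
  obtain y where y: "\<And>f. f \<in> out_arcs (with_proj G) z \<Longrightarrow> y f \<noteq> (0::complex)"
    "\<And>f. f \<in> out_arcs (with_proj G) z \<Longrightarrow> norm (x f) * norm (\<Sum>g\<in>out_arcs (with_proj G) z.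
        sgn (edge_arg f - edge_arg g) *\<^sub>R (norm (x g) *\<^sub>R y g)) = xi G x z * norm (y f)"
    using sgn_kernel_extremal[OF finite_out_arcs inj_on_edge_arg_out_arcs x' xi_eqI[OF ne]]
    by blast
  \<comment> \<open>Undoes the phases absorbed in \<open>norm_transition_matrix_row\<close>; the
    extension by 0 silences the other blocks.\<close>
  define v where "v g = (if g \<in> out_arcs (with_proj G) z
    then y g / (sgn (x g) * cis (edge_arg g / 2)) else 0)" for g
  have v: "sgn (x g) * cis (edge_arg g / 2) * v g = y g" if "g \<in> out_arcs (with_proj G) z" for g
    using nonzero[of g] that by (simp add: v_def sgn_zero_iff)
  show ?thesis
  proof
    fix f assume f: "f \<in> out_arcs (with_proj G) z"
    show "v f \<noteq> 0" using y(1)[OF f] v[OF f] by auto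
    have "norm (v f) = norm (y f)" using nonzero[of f] f by (simp flip: v[OF f] add: norm_mult norm_sgn)
    then show "norm (\<Sum>g\<in>parcs G. transition_matrix x (prod.swap f) g * v g) = xi G x z * norm (v f)"
      using norm_transition_matrix_row[OF f, of v] y(2)[OF f] v by simp
  qed (simp add: v_def del: in_out_arcs_conv)
qed

end

section \<open>The norm as the largest block norm\<close>

theorem lemma2p4:
  fixes G :: "complex pair_pre_digraph"
    and x :: "complex \<times> complex \<Rightarrow> complex"
  assumes "pair_graph G"
    and "pverts G \<noteq> {}"
    and "straight_line_embedded G"
    and "\<And>e. e \<in> parcs G \<Longrightarrow> x e \<noteq> 0"
  shows "matrix_opnorm (parcs G) (transition_matrix x) = Max (xi G x ` pverts G)"
proof -
  interpret weighted_embedded_graph G x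
    using assms(1,3,4) by (simp add: weighted_embedded_graph_def weighted_embedded_graph_axioms_def)
  define M where "M = Max (xi G x ` pverts G)"
  define W where "W v f = norm (\<Sum>g\<in>parcs G. transition_matrix x f g * v g)" for v f
  have xiM: "xi G x z \<le> M" if "z \<in> pverts G" for z
    using that pair_finite_verts by (simp add: M_def)
  have M0: "0 \<le> M" using assms(2) xiM xi_nonneg by (meson all_not_in_conv order_trans)
  have W: "(\<Sum>e\<in>parcs G. (W v e)\<^sup>2)
      = (\<Sum>z\<in>pverts G. \<Sum>f\<in>out_arcs (with_proj G) z. (W v (prod.swap f))\<^sup>2)" for v
    using sum_parcs_swap[of "\<lambda>e. (W v e)\<^sup>2"]
    by (simp add: sum_parcs_eq_sum_out_arcs[of "\<lambda>e. (W v (prod.swap e))\<^sup>2"])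
  have upper: "L2_set (W v) (parcs G) / L2_set (\<lambda>f. norm (v f)) (parcs G) \<le> M" for v
  proof -
    have "(\<Sum>e\<in>parcs G. (W v e)\<^sup>2) \<le> (\<Sum>z\<in>pverts G. M\<^sup>2 * (\<Sum>f\<in>out_arcs (with_proj G) z. (norm (v f))\<^sup>2))"
      unfolding W
    proof (rule sum_mono)
      fix z assume z: "z \<in> pverts G"
      have "(\<Sum>f\<in>out_arcs (with_proj G) z. (W v (prod.swap f))\<^sup>2)
          \<le> (xi G x z)\<^sup>2 * (\<Sum>f\<in>out_arcs (with_proj G) z. (norm (v f))\<^sup>2)"
        unfolding W_def by (rule transition_matrix_block_bound)
      also have "\<dots> \<le> M\<^sup>2 * (\<Sum>f\<in>out_arcs (with_proj G) z. (norm (v f))\<^sup>2)"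
        using xiM[OF z] xi_nonneg by (intro mult_right_mono power_mono sum_nonneg) auto
      finally show "(\<Sum>f\<in>out_arcs (with_proj G) z. (W v (prod.swap f))\<^sup>2)
          \<le> M\<^sup>2 * (\<Sum>f\<in>out_arcs (with_proj G) z. (norm (v f))\<^sup>2)" .
    qed
    also have "\<dots> = M\<^sup>2 * (\<Sum>f\<in>parcs G. (norm (v f))\<^sup>2)"
      by (simp add: sum_parcs_eq_sum_out_arcs[of "\<lambda>f. (norm (v f))\<^sup>2"] sum_distrib_left)
    finally have "L2_set (W v) (parcs G) \<le> M * L2_set (\<lambda>f. norm (v f)) (parcs G)"
      unfolding L2_set_def using M0 by (metis real_sqrt_le_mono real_sqrt_mult real_sqrt_abs abs_of_nonneg)
    then show ?thesis
      \<comment> \<open>If \<open>v\<close> vanishes on the edges, the quotient is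
        \<open>0 / 0 = 0\<close>, which \<open>M0\<close> covers.\<close>
      using M0 by (cases "L2_set (\<lambda>f. norm (v f)) (parcs G) = 0")
        (auto simp: divide_le_eq L2_set_nonneg less_le)
  qed
  have "\<exists>v. L2_set (W v) (parcs G) / L2_set (\<lambda>f. norm (v f)) (parcs G) = M"
  proof -
    obtain z where z: "z \<in> pverts G" "xi G x z = M"
      using Max_in[of "xi G x ` pverts G"] assms(2) pair_finite_verts unfolding M_def by fastforce
    show ?thesis
    proof (cases "out_arcs (with_proj G) z = {}")
      case True
      then have "M = 0" using z by (simp add: xi_def)
      \<comment> \<open>At an isolated maximizing vertex the value 0 is attained by the zero vector,
        again as \<open>0 / 0\<close>.\<close>
      then show ?thesis by (intro exI[of _ "\<lambda>_. 0"]) (simp add: L2_set_def)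
    next
      case False
      obtain v where v: "\<And>f. f \<in> out_arcs (with_proj G) z \<Longrightarrow> v f \<noteq> 0"
        "\<And>f. f \<notin> out_arcs (with_proj G) z \<Longrightarrow> v f = 0"
        "\<And>f. f \<in> out_arcs (with_proj G) z \<Longrightarrow> W v (prod.swap f) = M * norm (v f)"
        using transition_matrix_block_extremal[OF False] unfolding W_def z(2) by blast
      have "W v (prod.swap f) = M * norm (v f)" if "f \<in> parcs G" for f
      proof (cases "f \<in> out_arcs (with_proj G) z")
        case False
        \<comment> \<open>The row of \<open>prod.swap f\<close> meets only columns with the tail of
          \<open>f\<close>, which is not \<open>z\<close>; there \<open>v\<close> is 0.\<close>
        then have "transition_matrix x (prod.swap f) g * v g = 0" for g
          using v(2)[of g] that by (auto simp: transition_matrix_def)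
        then have "W v (prod.swap f) = 0" unfolding W_def by (simp only: sum.neutral_const norm_zero)
        then show ?thesis using v(2)[OF False] by simp
      qed (rule v(3))
      then have "(\<Sum>e\<in>parcs G. (W v e)\<^sup>2) = M\<^sup>2 * (\<Sum>f\<in>parcs G. (norm (v f))\<^sup>2)"
        unfolding sum_parcs_swap[of "\<lambda>e. (W v e)\<^sup>2", symmetric]
        by (simp add: power_mult_distrib sum_distrib_left)
      then have "L2_set (W v) (parcs G) = M * L2_set (\<lambda>f. norm (v f)) (parcs G)"
        using M0 by (simp add: L2_set_def real_sqrt_mult)
      moreover have "L2_set (\<lambda>f. norm (v f)) (parcs G) \<noteq> 0"
        using v(1) False pair_finite_arcs by (auto simp: L2_set_eq_0_iff)
      ultimately have "L2_set (W v) (parcs G) / L2_set (\<lambda>f. norm (v f)) (parcs G) = M" by simp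
      then show ?thesis by (rule exI[of _ v])
    qed
  qed
  then obtain v where v: "L2_set (W v) (parcs G) / L2_set (\<lambda>f. norm (v f)) (parcs G) = M" by blast
  have "(SUP v. L2_set (W v) (parcs G) / L2_set (\<lambda>f. norm (v f)) (parcs G)) = M"
  proof (rule cSup_eq_maximum)
    show "M \<in> range (\<lambda>v. L2_set (W v) (parcs G) / L2_set (\<lambda>f. norm (v f)) (parcs G))"
      by (rule range_eqI[of _ _ v]) (rule v[symmetric])
  next
    fix q assume "q \<in> range (\<lambda>v. L2_set (W v) (parcs G) / L2_set (\<lambda>f. norm (v f)) (parcs G))"
    then show "q \<le> M" using upper by blast
  qed
  then show ?thesis unfolding matrix_opnorm_def M_def W_def .
qed

end
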